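(* Let $k\ge 0$ be an integer and let $D$ be an oriented graph of order $n\ge 30+4(k-1)$. If $s^*(D)\ge 8k$, then there is a Hamilton oriented cycle $C$ in $D$ such that $\sigma_{\max}(C)\ge\left\lceil\frac{n+k}{2}\right\rceil$.
   Context: An oriented graph is a finite loopless digraph with at most one arc between any pair of vertices; a tournament is an oriented graph with exactly one arc between every pair of distinct vertices. The order is the number of vertices. The degree $d(x)$ of a vertex $x$ in $D$ is its degree in the underlying undirected graph $U(D)$ (obtained by removing the orientations of all arcs), i.e. the number of arcs incident with $x$. For an $n$-vertex oriented graph $D$ with arc set $A(D)$, define $s^*(D)=\min\{d(u)+d(v)-n : u\ne v\in V(D),\ \{uv,vu\}\cap A(D)=\emptyset\}$ if there is a pair of non-adjacent vertices in $D$ (a pair of distinct vertices with no arc between them), and $s^*(D)=n-2$ if $D$ is a tournament. An oriented cycle in $D$ is a subdigraph $Q$ of $D$ whose underlying graph $U(Q)$ is a cycle in $U(D)$ (arcs need not be consistently oriented); it is Hamilton if it is spanning. For an oriented cycle $C=x_1x_2\dots x_tx_1$ (indices modulo $t$), the arc of $C$ between $x_i$ and $x_{i+1}$ is forward if it is directed from $x_i$ to $x_{i+1}$ and backward if it is directed from $x_{i+1}$ to $x_i$. $\sigma^+(C)$ and $\sigma^-(C)$ denote the numbers of forward and backward arcs of $C$, respectively, and $\sigma_{\max}(C)=\max\{\sigma^+(C),\sigma^-(C)\}$ (which does not depend on the direction of traversal). *)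

theory Defs
  imports Complex_Main "Graph_Theory.Digraph_Component"
begin

locale oriented_graph = pair_digraph +
  assumes no_opposite_arcs: "(u, v) \<in> parcs G \<Longrightarrow> (v, u) \<notin> parcs G"

(* Undirected graphs are modelled as symmetric digraphs, as in Graph_Theory, so the
   underlying graph U(D) is the symmetric closure of D. *)
definition underlying_graph :: "'a pair_pre_digraph \<Rightarrow> 'a pair_pre_digraph" where
  "underlying_graph D = mk_symmetric (with_proj D)"

(* An edge {x, y} of U(D) is the pair of arcs (x, y), (y, x); exactly one of them leaves x, so
   the out-degree in U(D) is the undirected degree. *)
definition vertex_degree :: "'a pair_pre_digraph \<Rightarrow> 'a \<Rightarrow> nat" where
  "vertex_degree D x = out_degree (with_proj (underlying_graph D)) x"

definition nonadjacent_pairs :: "'a pair_pre_digraph \<Rightarrow> ('a \<times> 'a) set" where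
  "nonadjacent_pairs D = {(u, v). u \<in> pverts D \<and> v \<in> pverts D \<and> u \<noteq> v \<and>
     (u, v) \<notin> parcs D \<and> (v, u) \<notin> parcs D}"

(* Integer-valued: the value is negative when the degree sums are small. For an oriented graph,
   the second branch is exactly the case of a tournament. *)
definition s_star :: "'a pair_pre_digraph \<Rightarrow> int" where
  "s_star D =
     (if nonadjacent_pairs D \<noteq> {}
      then Min {int (vertex_degree D u) + int (vertex_degree D v) - int (card (pverts D)) | u v.
                  (u, v) \<in> nonadjacent_pairs D}
      else int (card (pverts D)) - 2)"

(* The list [x_1, ..., x_t] stands for the closed sequence x_1 x_2 ... x_t x_1 (indices
   modulo t). In an oriented graph it determines the subdigraph Q: the unique arc between each
   two consecutive vertices. The condition 3 \<le> t is that of a cycle in an undirected simple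
   graph. *)
definition oriented_cycle :: "'a pair_pre_digraph \<Rightarrow> 'a list \<Rightarrow> bool" where
  "oriented_cycle D xs \<longleftrightarrow> 3 \<le> length xs \<and> distinct xs \<and> set xs \<subseteq> pverts D \<and>
     (\<forall>i < length xs. (xs ! i, xs ! (Suc i mod length xs)) \<in> parcs (underlying_graph D))"

definition hamilton_oriented_cycle :: "'a pair_pre_digraph \<Rightarrow> 'a list \<Rightarrow> bool" where
  "hamilton_oriented_cycle D xs \<longleftrightarrow> oriented_cycle D xs \<and> set xs = pverts D"

definition sigma_plus :: "'a pair_pre_digraph \<Rightarrow> 'a list \<Rightarrow> nat" where
  "sigma_plus D xs = card {i. i < length xs \<and> (xs ! i, xs ! (Suc i mod length xs)) \<in> parcs D}"

definition sigma_minus :: "'a pair_pre_digraph \<Rightarrow> 'a list \<Rightarrow> nat" where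
  "sigma_minus D xs = card {i. i < length xs \<and> (xs ! (Suc i mod length xs), xs ! i) \<in> parcs D}"

definition sigma_max :: "'a pair_pre_digraph \<Rightarrow> 'a list \<Rightarrow> nat" where
  "sigma_max D xs = max (sigma_plus D xs) (sigma_minus D xs)"

end

theory Submission
  imports Defs "HOL-Library.Multiset"
begin

text \<open>
  Give a step from \<open>x\<close> to \<open>y\<close> along an edge the weight \<open>f x y = 1\<close> if the arc is forward and \<open>-1\<close> if
  it is backward. On a Hamilton cycle \<open>C\<close> the numbers of forward and backward arcs add up to \<open>n\<close>, so
  it suffices to find \<open>C\<close> on which the weights sum to at least \<open>k\<close> in absolute value. Two Hamilton
  cycles whose sums differ by at least \<open>2 * k\<close> are enough, since then one of them works.

  The two cycles differ only on \<open>k\<close> disjoint gadgets. A gadget is a path \<open>a x y b\<close> in which \<open>a\<close> and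
  \<open>b\<close> are both adjacent to both ends of the edge \<open>xy\<close>, so that it can be replaced by \<open>a y x b\<close> inside
  any cycle; the replacement must change the sum by at least 2. The change is \<open>s a + s b\<close>, where
  \<open>s z = f z y - f z x - f x y\<close> is the sum around the triangle \<open>zyx\<close>, an odd number.
  Among three odd numbers two have the same sign, so every edge with three common neighbours is the
  middle of a gadget (\<open>gadget_exists\<close>). A surplus in Ore's degree condition produces such an edge
  (\<open>edge_with_three_common_neighbours\<close>), and deleting a gadget lowers a degree sum by at most 8, so
  a surplus of \<open>8 * k\<close> pays for \<open>k\<close> disjoint gadgets (\<open>disjoint_gadgets\<close>).

  It remains to pass a Hamilton cycle through all gadgets. The vertex set is cut into blocks, namely
  the gadgets and the single remaining vertices, and Ore's rotation argument is run on cyclic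
  sequences of blocks that may be permuted and reversed but never broken (\<open>hamilton_block_cycle\<close>).
  In the cycle of blocks every gadget can be switched independently of the others, and switching
  each in the better or in the worse direction gives the two cycles (\<open>exists_large_cycle_sum\<close>).
\<close>

section \<open>Sums along walks and cycles\<close>

fun walk_sum :: "('a \<Rightarrow> 'a \<Rightarrow> 'b::comm_monoid_add) \<Rightarrow> 'a list \<Rightarrow> 'b" where
  "walk_sum w (x # y # zs) = w x y + walk_sum w (y # zs)"
| "walk_sum w xs = 0"

definition cycle_sum :: "('a \<Rightarrow> 'a \<Rightarrow> 'b::comm_monoid_add) \<Rightarrow> 'a list \<Rightarrow> 'b" where
  "cycle_sum w xs = walk_sum w (xs @ [hd xs])"

lemma walk_sum_append:
  assumes "xs \<noteq> []" "ys \<noteq> []"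
  shows "walk_sum w (xs @ ys) = walk_sum w xs + w (last xs) (hd ys) + walk_sum w ys"
  using assms
proof (induction xs rule: induct_list012)
  case (2 x)
  then show ?case by (cases ys) auto
next
  case (3 x y zs)
  then show ?case by (simp add: add.assoc)
qed simp

lemma walk_sum_rev: "walk_sum w (rev xs) = walk_sum (\<lambda>x y. w y x) xs"
proof (induction xs rule: induct_list012)
  case (3 x y zs)
  have "walk_sum w (rev (x # y # zs)) = walk_sum w (rev (y # zs) @ [x])" by simp
  also have "\<dots> = walk_sum w (rev (y # zs)) + w y x"
    by (subst walk_sum_append) auto
  finally show ?case using 3 by (simp add: add.commute)
qed simp_all

lemma walk_sum_map: "walk_sum w (map g xs) = walk_sum (\<lambda>x y. w (g x) (g y)) xs"
  by (induction xs rule: induct_list012) auto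

lemma walk_sum_nth: "walk_sum w xs = (\<Sum>i<length xs - 1. w (xs ! i) (xs ! Suc i))"
proof (induction xs rule: induct_list012)
  case (3 x y zs)
  then show ?case by (simp add: sum.lessThan_Suc_shift del: sum.lessThan_Suc)
qed simp_all

text \<open>
  For a sequence cut into blocks the sum splits into a part inside the blocks and a part that sees
  only the last and first elements of neighbouring blocks. Hence altering the interior of one block
  affects no other term.
\<close>

lemma walk_sum_concat:
  assumes "\<And>b. b \<in> set bs \<Longrightarrow> b \<noteq> []"
  shows "walk_sum w (concat bs) =
    sum_list (map (walk_sum w) bs) + walk_sum (\<lambda>b c. w (last b) (hd c)) bs"
  using assms
proof (induction bs rule: induct_list012)
  case (3 b c bs)
  have "walk_sum w (concat (b # c # bs)) =
      walk_sum w b + w (last b) (hd (concat (c # bs))) + walk_sum w (concat (c # bs))"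
    unfolding concat.simps(2)[of b] using 3(3) by (subst walk_sum_append) auto
  moreover have "hd (concat (c # bs)) = hd c" using 3(3) by simp
  ultimately show ?case using 3 by (simp add: add_ac)
qed simp_all

lemma cycle_sum_nth:
  "cycle_sum w xs = (\<Sum>i<length xs. w (xs ! i) (xs ! (Suc i mod length xs)))"
proof -
  have "(xs @ [hd xs]) ! Suc i = xs ! (Suc i mod length xs)" if "i < length xs" for i
  proof (cases "Suc i = length xs")
    case True
    then show ?thesis using that by (cases xs) (auto simp: nth_append)
  next
    case False
    then show ?thesis using that by (auto simp: nth_append)
  qed
  then show ?thesis
    unfolding cycle_sum_def walk_sum_nth by (auto simp: nth_append intro!: sum.cong)
qed

lemma cycle_sum_append:
  assumes "xs \<noteq> []" "ys \<noteq> []"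
  shows "cycle_sum w (xs @ ys) =
    walk_sum w xs + w (last xs) (hd ys) + walk_sum w ys + w (last ys) (hd xs)"
proof -
  have "cycle_sum w (xs @ ys) = walk_sum w (xs @ ys @ [hd xs])"
    using assms by (simp add: cycle_sum_def)
  also have "\<dots> = walk_sum w xs + w (last xs) (hd ys) + walk_sum w (ys @ [hd xs])"
    using assms by (subst walk_sum_append) auto
  also have "walk_sum w (ys @ [hd xs]) = walk_sum w ys + w (last ys) (hd xs)"
    using assms by (subst walk_sum_append) auto
  finally show ?thesis by (simp add: add_ac)
qed

lemma cycle_sum_rotate: "cycle_sum w (xs @ ys) = cycle_sum w (ys @ xs)"
  by (cases "xs = [] \<or> ys = []") (auto simp: cycle_sum_append add_ac)

lemma cycle_sum_concat:
  assumes "\<And>b. b \<in> set bs \<Longrightarrow> b \<noteq> []"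
  shows "cycle_sum w (concat bs) =
    sum_list (map (walk_sum w) bs) + cycle_sum (\<lambda>b c. w (last b) (hd c)) bs"
proof (cases bs)
  case (Cons b bs')
  have "cycle_sum w (concat bs) = walk_sum w (concat (bs @ [[hd b]]))"
    using assms Cons by (simp add: cycle_sum_def)
  also have "\<dots> = sum_list (map (walk_sum w) (bs @ [[hd b]])) +
      walk_sum (\<lambda>b c. w (last b) (hd c)) (bs @ [[hd b]])"
    by (rule walk_sum_concat) (use assms in auto)
  also have "walk_sum (\<lambda>b c. w (last b) (hd c)) (bs @ [[hd b]]) =
      cycle_sum (\<lambda>b c. w (last b) (hd c)) bs"
    using Cons by (subst walk_sum_append) (auto simp: cycle_sum_def walk_sum_append simp del: append_Cons)
  finally show ?thesis by simp
qed (simp add: cycle_sum_def)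

lemma walk_sum_nonzeroE:
  fixes w :: "'a \<Rightarrow> 'a \<Rightarrow> nat"
  assumes "walk_sum w zs \<noteq> 0"
  obtains p x y q where "zs = p @ x # y # q" "w x y \<noteq> 0"
proof -
  have "\<exists>p x y q. zs = p @ x # y # q \<and> w x y \<noteq> 0"
    using assms
  proof (induction zs rule: induct_list012)
    case (3 x y zs)
    show ?case
    proof (cases "w x y = 0")
      case True
      then obtain p x' y' q where "y # zs = p @ x' # y' # q \<and> w x' y' \<noteq> 0" using 3 by auto
      then show ?thesis by (metis append_Cons)
    next
      case False
      then show ?thesis by (metis append_Nil)
    qed
  qed simp_all
  with that show thesis by blast
qed

text \<open>
  With \<open>w\<close> counting non-edges: a cyclic sequence that has a non-edge somewhere can be cut open there,
  so that the non-edge runs from the last element back to the first.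
\<close>

lemma cycle_sum_nonzeroE:
  fixes w :: "'a \<Rightarrow> 'a \<Rightarrow> nat"
  assumes "cycle_sum w xs \<noteq> 0"
  obtains p q where "xs = p @ q" "w (last (q @ p)) (hd (q @ p)) \<noteq> 0"
proof -
  obtain p x y q where *: "xs @ [hd xs] = p @ x # y # q" "w x y \<noteq> 0"
    using walk_sum_nonzeroE assms unfolding cycle_sum_def by blast
  show thesis
  proof (cases q rule: rev_cases)
    case Nil
    then have "xs = p @ [x]" "y = hd xs" using *(1) by auto
    then show thesis using that[of "[]" xs] *(2) by auto
  next
    case (snoc q' z)
    then have "xs = (p @ [x]) @ (y # q')" using *(1) by auto
    then show thesis using that[of "p @ [x]" "y # q'"] *(2) by auto
  qed
qed

section \<open>Hamilton cycles through prescribed paths\<close>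

text \<open>
  Equality up to permuting the blocks and reversing some of them; a block is identified with its
  reversal by passing to the set of the two.
\<close>

definition same_blocks :: "'a list list \<Rightarrow> 'a list list \<Rightarrow> bool" where
  "same_blocks bs cs \<longleftrightarrow> mset (map (\<lambda>b. {b, rev b}) bs) = mset (map (\<lambda>b. {b, rev b}) cs)"

text \<open>
  The one invariance principle for \<open>same_blocks\<close>; with suitable \<open>h\<close> it preserves the vertex set,
  the absence of empty blocks, and the total of any quantity that ignores direction.
\<close>

lemma same_blocks_sum_list:
  fixes h :: "'a list \<Rightarrow> 'b::comm_monoid_add"
  assumes "same_blocks bs cs" and h: "\<And>b. h (rev b) = h b"
  shows "sum_list (map h bs) = sum_list (map h cs)"
proof -
  define h' where "h' = (\<lambda>c. h (SOME b. b \<in> c))"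
  have h': "h' {b, rev b} = h b" for b
  proof -
    have "(SOME c. c \<in> {b, rev b}) \<in> {b, rev b}" by (rule someI[of _ b]) simp
    then show ?thesis using h by (auto simp: h'_def)
  qed
  have *: "sum_list (map h xs) = sum_mset (image_mset h' (mset (map (\<lambda>b. {b, rev b}) xs)))" for xs
    by (induction xs) (auto simp: h')
  show ?thesis using assms(1) by (simp only: * same_blocks_def)
qed

lemma same_blocks_length: "same_blocks bs cs \<Longrightarrow> length bs = length cs"
  unfolding same_blocks_def by (drule mset_eq_length) simp

lemma same_blocks_mset_concat: "same_blocks bs cs \<Longrightarrow> mset (concat bs) = mset (concat cs)"
  by (simp add: mset_concat same_blocks_sum_list)

lemma same_blocks_nonempty:
  assumes "same_blocks bs cs"
  shows "(\<forall>b\<in>set bs. b \<noteq> []) \<longleftrightarrow> (\<forall>b\<in>set cs. b \<noteq> [])"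
proof -
  let ?h = "\<lambda>b :: 'a list. of_bool (b = []) :: nat"
  have *: "(\<forall>b\<in>set xs. b \<noteq> []) \<longleftrightarrow> sum_list (map ?h xs) = 0" for xs by auto
  have "sum_list (map ?h bs) = sum_list (map ?h cs)"
    by (rule same_blocks_sum_list[OF assms]) simp
  then show ?thesis by (simp only: *)
qed

text \<open>
  As a weight, this makes \<open>walk_sum\<close> and \<open>cycle_sum\<close> count missing edges, so that a list is a path or
  a closed walk of the graph exactly if the sum is 0, and improving a sequence means lowering it.
\<close>

definition gap :: "('a \<Rightarrow> 'a \<Rightarrow> bool) \<Rightarrow> 'a \<Rightarrow> 'a \<Rightarrow> nat" where
  "gap E x y = of_bool (\<not> E x y)"

abbreviation link_gaps :: "('a \<Rightarrow> 'a \<Rightarrow> bool) \<Rightarrow> 'a list list \<Rightarrow> nat" where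
  "link_gaps E bs \<equiv> cycle_sum (\<lambda>b c. gap E (last b) (hd c)) bs"

lemma blocks_disjoint:
  assumes "\<forall>b\<in>set bs. b \<noteq> []" "distinct (concat bs)"
    and "i < length bs" "j < length bs" "i \<noteq> j"
  shows "set (bs ! i) \<inter> set (bs ! j) = {}"
proof -
  have "removeAll [] bs = bs" using assms(1) by (intro removeAll_id) auto
  then have "bs ! i \<noteq> bs ! j"
    using assms by (simp add: distinct_concat_iff nth_eq_iff_index_eq)
  then show ?thesis using assms by (simp add: distinct_concat_iff)
qed

text \<open>
  Counting for the rotation argument. The map \<open>e\<close> picks an end of each block, first or last, and
  \<open>p\<close> numbers the blocks other than the \<open>j\<close>-th by \<open>0, ..., length bs - 2\<close>. Since only
  \<open>card V - length bs\<close> vertices are not picked, all but that many neighbours of the picked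
  end of block \<open>j\<close> are themselves picked ends.
\<close>

lemma neighbours_among_block_ends:
  assumes ne: "\<forall>b\<in>set bs. b \<noteq> []" and dist: "distinct (concat bs)"
    and e: "\<And>b. b \<noteq> [] \<Longrightarrow> e b \<in> set b"
    and j: "j < length bs" and irr: "\<And>x. \<not> E x x"
    and img: "p ` {..<length bs - 1} = {..<length bs} - {j}"
  shows "card {w \<in> set (concat bs). E (e (bs ! j)) w} + length bs
    \<le> card (set (concat bs)) + card {i. i < length bs - 1 \<and> E (e (bs ! j)) (e (bs ! p i))}"
proof -
  let ?V = "set (concat bs)" and ?u = "e (bs ! j)"
  let ?H = "(\<lambda>i. e (bs ! i)) ` {..<length bs}"
  let ?I = "{i. i < length bs - 1 \<and> E ?u (e (bs ! p i))}"
  have eb: "e (bs ! i) \<in> set (bs ! i)" if "i < length bs" for i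
    using ne e that by simp
  have "i = i'" if "i < length bs" "i' < length bs" "e (bs ! i) = e (bs ! i')" for i i'
  proof (rule ccontr)
    assume "i \<noteq> i'"
    then have "set (bs ! i) \<inter> set (bs ! i') = {}"
      using blocks_disjoint ne dist that by blast
    then show False using eb that by fastforce
  qed
  then have "card ?H = length bs"
    by (subst card_image) (auto simp: inj_on_def)
  moreover have HV: "?H \<subseteq> ?V" using eb by fastforce
  ultimately have c: "card (?V - ?H) + length bs = card ?V"
    by (metis List.finite_set card_Diff_subset card_mono finite_subset le_add_diff_inverse2)
  have "{w \<in> ?V. E ?u w} \<subseteq> (?V - ?H) \<union> (\<lambda>i. e (bs ! p i)) ` ?I"
  proof
    fix w assume w: "w \<in> {w \<in> ?V. E ?u w}"
    show "w \<in> (?V - ?H) \<union> (\<lambda>i. e (bs ! p i)) ` ?I"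
    proof (cases "w \<in> ?H")
      case True
      then obtain i where i: "i < length bs" "w = e (bs ! i)" by auto
      then have "i \<in> {..<length bs} - {j}" using w irr by auto
      then obtain i' where "i' < length bs - 1" "i = p i'" using img by auto
      then show ?thesis using w i by auto
    qed (use w in auto)
  qed
  then have "card {w \<in> ?V. E ?u w} \<le> card ((?V - ?H) \<union> (\<lambda>i. e (bs ! p i)) ` ?I)"
    by (intro card_mono) auto
  also have "\<dots> \<le> card (?V - ?H) + card ?I"
    by (intro order_trans[OF card_Un_le] add_left_mono card_image_le) auto
  finally show ?thesis using c by simp
qed

text \<open>
  Ore's rotation. Let \<open>u\<close> be the first and \<open>v\<close> the last vertex, not adjacent. If \<open>u\<close> is adjacent to
  the start of a block and \<open>v\<close> to the end of the preceding block, then reversing everything from that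
  block on replaces the steps between the two blocks and from \<open>v\<close> to \<open>u\<close> by these two edges. The
  degree condition forces such a place: \<open>length bs - 1\<close> places are available, while \<open>u\<close> and \<open>v\<close>
  together have at least \<open>length bs\<close> suitable neighbours.
\<close>

lemma fewer_link_gaps:
  assumes sym: "\<And>x y. E x y \<Longrightarrow> E y x" and irr: "\<And>x. \<not> E x x"
    and ne: "\<forall>b\<in>set bs. b \<noteq> []" and dist: "distinct (concat bs)" and len: "2 \<le> length bs"
    and deg: "\<And>u v. u \<in> set (concat bs) \<Longrightarrow> v \<in> set (concat bs) \<Longrightarrow> u \<noteq> v \<Longrightarrow> \<not> E u v \<Longrightarrow>
      2 * card (set (concat bs)) \<le> card {w \<in> set (concat bs). E u w}
        + card {w \<in> set (concat bs). E v w} + length bs"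
    and gap: "gap E (last (last bs)) (hd (hd bs)) \<noteq> 0"
  shows "\<exists>cs. same_blocks cs bs \<and> link_gaps E cs < link_gaps E bs"
proof -
  let ?t = "length bs" and ?V = "set (concat bs)"
  let ?u = "hd (bs ! 0)" and ?v = "last (bs ! (length bs - 1))"
  let ?I = "{i. i < ?t - 1 \<and> E ?u (hd (bs ! Suc i))}"
  let ?J = "{i. i < ?t - 1 \<and> E ?v (last (bs ! i))}"
  have bsne: "bs \<noteq> []" using len by auto
  have uv: "?u = hd (hd bs)" "?v = last (last bs)" using bsne by (auto simp: hd_conv_nth last_conv_nth)
  have inV: "?u \<in> set (bs ! 0)" "?v \<in> set (bs ! (?t - 1))"
    using ne len bsne by auto
  then have inV': "?u \<in> ?V" "?v \<in> ?V" using len bsne by fastforce+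
  have "set (bs ! 0) \<inter> set (bs ! (?t - 1)) = {}"
    using len by (intro blocks_disjoint[OF ne dist]) auto
  then have "?u \<noteq> ?v" using inV by auto
  moreover have nE: "\<not> E ?u ?v" using gap sym unfolding uv gap_def by auto
  ultimately have "2 * card ?V \<le> card {w \<in> ?V. E ?u w} + card {w \<in> ?V. E ?v w} + ?t"
    using deg inV' by blast
  moreover have "card {w \<in> ?V. E ?u w} + ?t \<le> card ?V + card ?I"
    by (rule neighbours_among_block_ends[OF ne dist, where e = hd and j = 0 and p = Suc])
      (use irr len in \<open>auto simp: image_Suc_lessThan\<close>)
  moreover have "card {w \<in> ?V. E ?v w} + ?t \<le> card ?V + card ?J"
    by (rule neighbours_among_block_ends[OF ne dist, where e = last and j = "?t - 1" and p = "\<lambda>i. i"])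
      (use irr len in auto)
  moreover have "card (?I \<union> ?J) \<le> ?t - 1"
    by (rule order_trans[OF card_mono[of "{..<?t - 1}"]]) auto
  moreover have "card ?I + card ?J = card (?I \<union> ?J) + card (?I \<inter> ?J)"
    by (rule card_Un_Int) auto
  ultimately have "card (?I \<inter> ?J) \<noteq> 0" using len by linarith
  then obtain i where i: "i < ?t - 1" "E ?u (hd (bs ! Suc i))" "E ?v (last (bs ! i))"
    by (metis (mono_tags, lifting) Int_iff card.empty equals0I mem_Collect_eq)
  define P Q where "P = take (Suc i) bs" and "Q = drop (Suc i) bs"
  have PQ: "bs = P @ Q" "P \<noteq> []" "Q \<noteq> []" using i(1) by (auto simp: P_def Q_def)
  have ends: "last P = bs ! i" "hd Q = bs ! Suc i" "hd P = hd bs" "last Q = last bs"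
    subgoal using i(1) by (simp add: P_def take_Suc_conv_app_nth)
    subgoal using i(1) by (simp add: Q_def hd_drop_conv_nth)
    subgoal using PQ by simp
    subgoal using PQ by simp
    done
  have neQ: "b \<noteq> []" if "b \<in> set Q" for b using ne that unfolding PQ(1) by auto
  define cs where "cs = P @ map rev (rev Q)"
  let ?w = "\<lambda>b c. gap E (last b) (hd c)"
  have "same_blocks cs bs"
  proof -
    have "mset (map (\<lambda>b. {b, rev b}) (map rev (rev Q))) = mset (map (\<lambda>b. {b, rev b}) Q)"
      by (simp add: comp_def insert_commute)
    then show ?thesis unfolding same_blocks_def cs_def PQ(1) by simp
  qed
  moreover have "walk_sum ?w (map rev (rev Q)) = walk_sum ?w Q"
  proof -
    have *: "walk_sum ?w (map rev (rev Q)) = walk_sum (\<lambda>b c. gap E (hd c) (last b)) Q'"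
      if "Q' = Q" "\<And>b. b \<in> set Q \<Longrightarrow> b \<noteq> []" for Q'
      unfolding that(1) walk_sum_map walk_sum_rev using that(2)
      by (induction Q rule: induct_list012) (auto simp: hd_rev last_rev)
    have "gap E x y = gap E y x" for x y using sym by (auto simp: gap_def)
    with *[OF refl neQ] show ?thesis by simp
  qed
  moreover have "last (last P) = last (bs ! i)" "hd (hd (map rev (rev Q))) = ?v"
    "last (last (map rev (rev Q))) = hd (bs ! Suc i)" "hd (hd P) = ?u"
    using PQ neQ ends uv by (auto simp: hd_map last_map hd_rev last_rev)
  ultimately have "same_blocks cs bs" "link_gaps E cs = walk_sum ?w P + walk_sum ?w Q"
    unfolding cs_def using PQ i sym by (auto simp: cycle_sum_append gap_def)
  moreover have "link_gaps E bs = walk_sum ?w P + ?w (last P) (hd Q) + walk_sum ?w Q + ?w (last Q) (hd P)"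
    unfolding PQ(1) using PQ(2,3) by (rule cycle_sum_append)
  moreover have "?w (last Q) (hd P) \<noteq> 0" using gap ends by simp
  ultimately show ?thesis by (intro exI[of _ cs]) simp
qed

text \<open>
  If the blocks are paths with \<open>m\<close> edges in total, then \<open>length bs = card V - m\<close> and the
  condition says that nonadjacent vertices have degree sum at least \<open>card V + m\<close>. This is
  Posa's form of Ore's theorem. An arrangement with fewest gaps has none: otherwise, cut open at a
  gap, it could be improved by rotation.
\<close>

theorem hamilton_block_cycle:
  assumes sym: "\<And>x y. E x y \<Longrightarrow> E y x" and irr: "\<And>x. \<not> E x x"
    and ne: "\<forall>b\<in>set bs. b \<noteq> []" and dist: "distinct (concat bs)" and len: "2 \<le> length bs"
    and deg: "\<And>u v. u \<in> set (concat bs) \<Longrightarrow> v \<in> set (concat bs) \<Longrightarrow> u \<noteq> v \<Longrightarrow> \<not> E u v \<Longrightarrow>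
      2 * card (set (concat bs)) \<le> card {w \<in> set (concat bs). E u w}
        + card {w \<in> set (concat bs). E v w} + length bs"
  shows "\<exists>cs. same_blocks cs bs \<and> link_gaps E cs = 0"
proof -
  obtain cs where cs: "same_blocks cs bs"
    and least: "\<And>ds. same_blocks ds bs \<Longrightarrow> link_gaps E cs \<le> link_gaps E ds"
    using ex_has_least_nat[of "\<lambda>cs. same_blocks cs bs" bs "link_gaps E"]
    by (auto simp: same_blocks_def)
  have "link_gaps E cs = 0"
  proof (rule ccontr)
    assume "link_gaps E cs \<noteq> 0"
    then obtain p q where pq: "cs = p @ q" "gap E (last (last (q @ p))) (hd (hd (q @ p))) \<noteq> 0"
      by (rule cycle_sum_nonzeroE)
    define ds where "ds = q @ p"
    have ds: "same_blocks ds bs" using cs unfolding pq ds_def same_blocks_def by (simp add: add.commute)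
    have V: "set (concat ds) = set (concat bs)" "distinct (concat ds)"
      using same_blocks_mset_concat[OF ds] dist by (metis mset_eq_setD, metis mset_eq_imp_distinct_iff)
    have "\<exists>cs'. same_blocks cs' ds \<and> link_gaps E cs' < link_gaps E ds"
    proof (rule fewer_link_gaps)
      show "\<forall>b\<in>set ds. b \<noteq> []" using ne same_blocks_nonempty[OF ds] by simp
      show "2 \<le> length ds" using len same_blocks_length[OF ds] by simp
      show "gap E (last (last ds)) (hd (hd ds)) \<noteq> 0" using pq(2) unfolding ds_def .
      show "2 * card (set (concat ds)) \<le> card {w \<in> set (concat ds). E u w}
          + card {w \<in> set (concat ds). E v w} + length ds"
        if "u \<in> set (concat ds)" "v \<in> set (concat ds)" "u \<noteq> v" "\<not> E u v" for u v
        using deg[of u v] that unfolding V(1) same_blocks_length[OF ds] by blast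
    qed (fact sym irr V)+
    then obtain cs' where "same_blocks cs' ds" "link_gaps E cs' < link_gaps E ds" by blast
    moreover have "link_gaps E ds = link_gaps E cs" unfolding ds_def pq by (rule cycle_sum_rotate)
    moreover have "same_blocks cs' bs" using calculation(1) ds by (simp add: same_blocks_def)
    ultimately show False using least by fastforce
  qed
  with cs show ?thesis by blast
qed

section \<open>Switching gadgets\<close>

fun switch :: "'a list \<Rightarrow> 'a list" where
  "switch [a, x, y, b] = [a, y, x, b]"
| "switch bs = bs"

lemma mset_switch [simp]: "mset (switch b) = mset b"
  by (cases b rule: switch.cases) auto

lemma switch_eq_Nil [simp]: "switch b = [] \<longleftrightarrow> b = []"
  by (cases b rule: switch.cases) auto

lemma hd_switch [simp]: "hd (switch b) = hd b"
  by (cases b rule: switch.cases) auto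

lemma last_switch [simp]: "last (switch b) = last b"
  by (cases b rule: switch.cases) auto

lemma switch_other: "length b \<noteq> 4 \<Longrightarrow> switch b = b"
  by (cases b rule: switch.cases) auto

lemma switch_rev: "switch (rev b) = rev (switch b)"
  by (cases b rule: switch.cases) (auto simp: switch_other)

definition gain :: "('a \<Rightarrow> 'a \<Rightarrow> int) \<Rightarrow> 'a list \<Rightarrow> nat" where
  "gain f b = nat \<bar>walk_sum f (switch b) - walk_sum f b\<bar>"

text \<open>
  Zero means that a block is a path both before and after switching.
\<close>

definition inner_gaps :: "('a \<Rightarrow> 'a \<Rightarrow> bool) \<Rightarrow> 'a list \<Rightarrow> nat" where
  "inner_gaps E b = walk_sum (gap E) b + walk_sum (gap E) (switch b)"

lemma gain_rev:
  assumes "\<And>x y. f y x = - f x y"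
  shows "gain f (rev b) = gain f b"
proof -
  have "(\<lambda>x y. f y x) = (\<lambda>x y. - f x y)" using assms by blast
  moreover have "walk_sum (\<lambda>x y. - f x y) b = - walk_sum f b" for b
    by (induction b rule: induct_list012) auto
  ultimately have "walk_sum f (rev b) = - walk_sum f b" for b by (simp add: walk_sum_rev)
  then show ?thesis by (simp add: gain_def switch_rev)
qed

lemma inner_gaps_rev:
  assumes "\<And>x y. E x y \<Longrightarrow> E y x"
  shows "inner_gaps E (rev b) = inner_gaps E b"
proof -
  have "gap E y x = gap E x y" for x y using assms by (auto simp: gap_def)
  then have "walk_sum (gap E) (rev b) = walk_sum (gap E) b" for b by (simp add: walk_sum_rev)
  then show ?thesis by (simp add: inner_gaps_def switch_rev)
qed

lemma cycle_sum_switched: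
  assumes ne: "\<forall>b\<in>set bs. b \<noteq> []" and \<phi>: "\<And>b. \<phi> b = b \<or> \<phi> b = switch b"
  shows "cycle_sum w (concat (map \<phi> bs)) =
      sum_list (map (\<lambda>b. walk_sum w (\<phi> b)) bs) + cycle_sum (\<lambda>b c. w (last b) (hd c)) bs"
    and "mset (concat (map \<phi> bs)) = mset (concat bs)"
proof -
  have *: "\<phi> b = [] \<longleftrightarrow> b = []" "hd (\<phi> b) = hd b" "last (\<phi> b) = last b" "mset (\<phi> b) = mset b" for b
    using \<phi>[of b] by (metis switch_eq_Nil, metis hd_switch, metis last_switch, metis mset_switch)
  have "cycle_sum w (concat (map \<phi> bs)) = sum_list (map (walk_sum w) (map \<phi> bs)) +
      cycle_sum (\<lambda>b c. w (last b) (hd c)) (map \<phi> bs)"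
    by (rule cycle_sum_concat) (use ne * in auto)
  also have "cycle_sum (\<lambda>b c. w (last b) (hd c)) (map \<phi> bs) = cycle_sum (\<lambda>b c. w (last b) (hd c)) bs"
  proof -
    have "map \<phi> bs ! (Suc i mod length bs) = \<phi> (bs ! (Suc i mod length bs))"
      if "i < length bs" for i
      using that by (intro nth_map mod_less_divisor) (cases bs; simp)
    then show ?thesis unfolding cycle_sum_nth by (auto simp: * intro!: sum.cong)
  qed
  finally show "cycle_sum w (concat (map \<phi> bs)) =
      sum_list (map (\<lambda>b. walk_sum w (\<phi> b)) bs) + cycle_sum (\<lambda>b c. w (last b) (hd c)) bs"
    by (simp add: comp_def)
  show "mset (concat (map \<phi> bs)) = mset (concat bs)"
    by (simp add: mset_concat comp_def *)
qed

text \<open>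
  Switching each block in the direction that increases the sum, and in the opposite one, gives two
  cycles whose sums differ by the total gain; one of them is at least half the gain away from 0.
\<close>

lemma exists_large_cycle_sum:
  fixes f :: "'a \<Rightarrow> 'a \<Rightarrow> int"
  assumes ne: "\<forall>b\<in>set bs. b \<noteq> []"
    and int: "sum_list (map (inner_gaps E) bs) = 0" and lnk: "link_gaps E bs = 0"
  shows "\<exists>xs. mset xs = mset (concat bs) \<and> cycle_sum (gap E) xs = 0 \<and>
    int (sum_list (map (gain f) bs)) \<le> 2 * \<bar>cycle_sum f xs\<bar>"
proof -
  define up where "up b = (if walk_sum f b \<le> walk_sum f (switch b) then switch b else b)" for b
  define dn where "dn b = (if walk_sum f b \<le> walk_sum f (switch b) then b else switch b)" for b
  have up: "up b = b \<or> up b = switch b" and dn: "dn b = b \<or> dn b = switch b" for b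
    by (auto simp: up_def dn_def)
  have gap0: "cycle_sum (gap E) (concat (map \<phi> bs)) = 0"
    if \<phi>: "\<And>b. \<phi> b = b \<or> \<phi> b = switch b" for \<phi>
  proof -
    have "walk_sum (gap E) (\<phi> b) = 0" if "b \<in> set bs" for b
    proof -
      have "inner_gaps E b = 0" using int that by auto
      then show ?thesis using \<phi>[of b] by (auto simp: inner_gaps_def)
    qed
    then show ?thesis unfolding cycle_sum_switched(1)[OF ne \<phi>] using lnk by auto
  qed
  have "walk_sum f (up b) = walk_sum f (dn b) + int (gain f b)" for b
    by (auto simp: up_def dn_def gain_def)
  then have "sum_list (map (\<lambda>b. walk_sum f (up b)) bs) =
      sum_list (map (\<lambda>b. walk_sum f (dn b)) bs) + int (sum_list (map (gain f) bs))"
    by (induction bs) auto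
  then have "cycle_sum f (concat (map up bs)) - cycle_sum f (concat (map dn bs)) =
      int (sum_list (map (gain f) bs))"
    unfolding cycle_sum_switched(1)[OF ne up] cycle_sum_switched(1)[OF ne dn] by simp
  then have "int (sum_list (map (gain f) bs)) \<le> 2 * \<bar>cycle_sum f (concat (map up bs))\<bar> \<or>
      int (sum_list (map (gain f) bs)) \<le> 2 * \<bar>cycle_sum f (concat (map dn bs))\<bar>"
    by linarith
  then show ?thesis
    using gap0[OF up] gap0[OF dn] cycle_sum_switched(2)[OF ne up] cycle_sum_switched(2)[OF ne dn]
    by blast
qed

definition gadget :: "('a \<Rightarrow> 'a \<Rightarrow> bool) \<Rightarrow> ('a \<Rightarrow> 'a \<Rightarrow> int) \<Rightarrow> 'a list \<Rightarrow> bool" where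
  "gadget E f b \<longleftrightarrow> length b = 4 \<and> distinct b \<and> inner_gaps E b = 0 \<and> 2 \<le> gain f b"

text \<open>
  The sum \<open>s z\<close> around the triangle \<open>zyx\<close> is odd. Two of the three
  values for \<open>a, b, c\<close> have the same sign, so they add up to at least 2 in absolute value.
\<close>

lemma gadget_exists:
  fixes f :: "'a \<Rightarrow> 'a \<Rightarrow> int"
  assumes sym: "\<And>x y. E x y \<Longrightarrow> E y x" and irr: "\<And>x. \<not> E x x"
    and anti: "\<And>x y. f y x = - f x y" and unit: "\<And>x y. E x y \<Longrightarrow> \<bar>f x y\<bar> = 1"
    and xy: "E x y" and N: "3 \<le> card {z \<in> W. E x z \<and> E y z}" and W: "x \<in> W" "y \<in> W"
  shows "\<exists>b. gadget E f b \<and> set b \<subseteq> W"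
proof -
  obtain T where "T \<subseteq> {z \<in> W. E x z \<and> E y z}" "card T = 3"
    using obtain_subset_with_card_n[OF N] by blast
  then obtain a b c where abc: "a \<noteq> b" "b \<noteq> c" "a \<noteq> c" "{a, b, c} \<subseteq> {z \<in> W. E x z \<and> E y z}"
    by (metis card_3_iff)
  define s where "s z = f z y - f z x - f x y" for z
  have gad: "gadget E f [p, x, y, q] \<and> set [p, x, y, q] \<subseteq> W"
    if pq: "p \<noteq> q" "{p, q} \<subseteq> {z \<in> W. E x z \<and> E y z}" "2 \<le> \<bar>s p + s q\<bar>" for p q
  proof -
    have "walk_sum f (switch [p, x, y, q]) - walk_sum f [p, x, y, q] = s p + s q"
      using anti[of x q] anti[of y q] anti[of x y] by (simp add: s_def)
    then have "2 \<le> gain f [p, x, y, q]" using pq(3) by (simp only: gain_def)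
    moreover have "inner_gaps E [p, x, y, q] = 0"
      using pq(2) xy sym by (auto simp: inner_gaps_def gap_def)
    moreover have "distinct [p, x, y, q]" using pq(1,2) xy irr by auto
    ultimately show ?thesis using pq(2) W by (simp add: gadget_def)
  qed
  have s: "s z \<in> {-3, -1, 1, 3}" if "z \<in> {a, b, c}" for z
  proof -
    have "\<bar>f z y\<bar> = 1" "\<bar>f z x\<bar> = 1" "\<bar>f x y\<bar> = 1" using that abc(4) xy sym by (auto intro!: unit)
    then show ?thesis unfolding s_def by auto
  qed
  have "2 \<le> \<bar>s a + s b\<bar> \<or> 2 \<le> \<bar>s b + s c\<bar> \<or> 2 \<le> \<bar>s a + s c\<bar>"
    using s[of a] s[of b] s[of c] by auto
  then show ?thesis using gad[of a b] gad[of b c] gad[of a c] abc by (elim disjE) blast+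
qed

section \<open>Finding disjoint gadgets\<close>

text \<open>
  An edge between two vertices of degree at least \<open>(card W + 3) / 2\<close> has three common neighbours by
  inclusion-exclusion. The vertices of smaller degree form a clique \<open>S\<close>. If \<open>S\<close> has five elements,
  then any edge inside \<open>S\<close> has three common neighbours in \<open>S\<close>; otherwise a vertex outside \<open>S\<close> has so
  many neighbours that one of them lies outside \<open>S\<close> too.
\<close>

lemma edge_with_three_common_neighbours:
  assumes fin: "finite W" and W: "6 \<le> card W" and irr: "\<And>x. \<not> E x x"
    and deg: "\<And>u v. u \<in> W \<Longrightarrow> v \<in> W \<Longrightarrow> u \<noteq> v \<Longrightarrow> \<not> E u v \<Longrightarrow>
      card W + 3 \<le> card {w \<in> W. E u w} + card {w \<in> W. E v w}"
  shows "\<exists>x\<in>W. \<exists>y\<in>W. E x y \<and> 3 \<le> card {z \<in> W. E x z \<and> E y z}"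
proof -
  define d where "d v = card {w \<in> W. E v w}" for v
  define S where "S = {v \<in> W. 2 * d v < card W + 3}"
  have clique: "E u v" if "u \<in> S" "v \<in> S" "u \<noteq> v" for u v
  proof (rule ccontr)
    assume "\<not> E u v"
    then have "card W + 3 \<le> d u + d v" using deg[of u v] that unfolding S_def d_def by auto
    then show False using that unfolding S_def by auto
  qed
  have "finite S" using fin unfolding S_def by auto
  show ?thesis
  proof (cases "5 \<le> card S")
    case True
    obtain T where "T \<subseteq> S" "card T = 2"
      using obtain_subset_with_card_n[of 2 S] True by auto
    then obtain x y where xy: "x \<in> S" "y \<in> S" "x \<noteq> y" by (auto simp: card_2_iff)
    have "3 \<le> card (S - {x, y})" using True xy \<open>finite S\<close> by (subst card_Diff_subset) auto
    also have "\<dots> \<le> card {z \<in> W. E x z \<and> E y z}"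
      using fin xy clique by (intro card_mono) (auto simp: S_def)
    finally show ?thesis using xy clique[OF xy] unfolding S_def by blast
  next
    case False
    then have "\<not> W \<subseteq> S" using W card_mono[OF \<open>finite S\<close>, of W] by linarith
    then obtain x where x: "x \<in> W" "card W + 3 \<le> 2 * d x" unfolding S_def by fastforce
    have "\<not> {w \<in> W. E x w} \<subseteq> S"
      using False W x(2) card_mono[OF \<open>finite S\<close>, of "{w \<in> W. E x w}"] unfolding d_def by linarith
    then obtain y where y: "y \<in> W" "E x y" "card W + 3 \<le> 2 * d y" unfolding S_def by fastforce
    have "d x + d y = card ({w \<in> W. E x w} \<union> {w \<in> W. E y w}) + card ({w \<in> W. E x w} \<inter> {w \<in> W. E y w})"
      unfolding d_def using fin by (intro card_Un_Int) auto
    also have "{w \<in> W. E x w} \<inter> {w \<in> W. E y w} = {z \<in> W. E x z \<and> E y z}" by auto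
    also have "card ({w \<in> W. E x w} \<union> {w \<in> W. E y w}) \<le> card W"
      using fin by (intro card_mono) auto
    finally have "3 \<le> card {z \<in> W. E x z \<and> E y z}" using x y by linarith
    then show ?thesis using x y by blast
  qed
qed

text \<open>
  The gadgets are found greedily. Deleting \<open>j\<close> of them lowers the order by \<open>4 * j\<close> and a degree sum
  by at most \<open>8 * j\<close>, and for \<open>j < k\<close> a surplus of at least 8 and at least 6 vertices are left.
\<close>

lemma disjoint_gadgets:
  fixes f :: "'a \<Rightarrow> 'a \<Rightarrow> int"
  assumes sym: "\<And>x y. E x y \<Longrightarrow> E y x" and irr: "\<And>x. \<not> E x x"
    and anti: "\<And>x y. f y x = - f x y" and unit: "\<And>x y. E x y \<Longrightarrow> \<bar>f x y\<bar> = 1"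
    and fin: "finite V" and V: "4 * k + 2 \<le> card V"
    and deg: "\<And>u v. u \<in> V \<Longrightarrow> v \<in> V \<Longrightarrow> u \<noteq> v \<Longrightarrow> \<not> E u v \<Longrightarrow>
      card V + 8 * k \<le> card {w \<in> V. E u w} + card {w \<in> V. E v w}"
  shows "j \<le> k \<Longrightarrow> \<exists>gs. length gs = j \<and> (\<forall>g\<in>set gs. gadget E f g) \<and>
    distinct (concat gs) \<and> set (concat gs) \<subseteq> V"
proof (induction j)
  case 0
  then show ?case by auto
next
  case (Suc j)
  then obtain gs where gs: "length gs = j" "\<forall>g\<in>set gs. gadget E f g"
    "distinct (concat gs)" "set (concat gs) \<subseteq> V" by auto
  define U where "U = set (concat gs)"
  have "length (concat gs) = 4 * j"
    using gs(1,2) by (induction gs arbitrary: j) (auto simp: gadget_def)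
  then have U: "card U = 4 * j" using gs(3) unfolding U_def by (simp only: distinct_card)
  have cW: "card (V - U) = card V - 4 * j"
    using U gs(4) fin unfolding U_def by (subst card_Diff_subset) auto
  have degW: "card {w \<in> V. E u w} \<le> card {w \<in> V - U. E u w} + 4 * j" for u
  proof -
    have "card {w \<in> V. E u w} \<le> card ({w \<in> V - U. E u w} \<union> U)"
      using fin by (intro card_mono) (auto simp: U_def)
    also have "\<dots> \<le> card {w \<in> V - U. E u w} + card U" by (rule card_Un_le)
    finally show ?thesis using U by simp
  qed
  have "\<exists>x\<in>V - U. \<exists>y\<in>V - U. E x y \<and> 3 \<le> card {z \<in> V - U. E x z \<and> E y z}"
  proof (rule edge_with_three_common_neighbours)
    show "card (V - U) + 3 \<le> card {w \<in> V - U. E u w} + card {w \<in> V - U. E v w}"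
      if "u \<in> V - U" "v \<in> V - U" "u \<noteq> v" "\<not> E u v" for u v
      using deg[of u v] degW[of u] degW[of v] that cW Suc.prems V by auto
  qed (use fin irr cW V Suc.prems in auto)
  then obtain x y where "x \<in> V - U" "y \<in> V - U" "E x y" "3 \<le> card {z \<in> V - U. E x z \<and> E y z}"
    by blast
  then obtain g where g: "gadget E f g" "set g \<subseteq> V - U"
    using gadget_exists[of E f x y "V - U"] sym irr anti unit by blast
  then have "length (g # gs) = Suc j \<and> (\<forall>h\<in>set (g # gs). gadget E f h) \<and>
      distinct (concat (g # gs)) \<and> set (concat (g # gs)) \<subseteq> V"
    using gs unfolding U_def gadget_def by auto
  then show ?case by blast
qed

section \<open>Hamilton oriented cycles with many arcs in one direction\<close>

text \<open>
  The cutting into \<open>k\<close> gadgets and single vertices has \<open>card V - 3 * k\<close> blocks, so a degree sum of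
  \<open>card V + 3 * k\<close> is what \<open>hamilton_block_cycle\<close> asks for; the surplus \<open>8 * k\<close> that the gadgets need
  covers it.
\<close>

theorem hamilton_cycle_with_large_sum:
  fixes f :: "'a \<Rightarrow> 'a \<Rightarrow> int"
  assumes sym: "\<And>x y. E x y \<Longrightarrow> E y x" and irr: "\<And>x. \<not> E x x"
    and anti: "\<And>x y. f y x = - f x y" and unit: "\<And>x y. E x y \<Longrightarrow> \<bar>f x y\<bar> = 1"
    and fin: "finite V" and V: "4 * k + 2 \<le> card V"
    and deg: "\<And>u v. u \<in> V \<Longrightarrow> v \<in> V \<Longrightarrow> u \<noteq> v \<Longrightarrow> \<not> E u v \<Longrightarrow>
      card V + 8 * k \<le> card {w \<in> V. E u w} + card {w \<in> V. E v w}"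
  shows "\<exists>xs. distinct xs \<and> set xs = V \<and> cycle_sum (gap E) xs = 0 \<and> int k \<le> \<bar>cycle_sum f xs\<bar>"
proof -
  obtain gs where gs: "length gs = k" "\<forall>g\<in>set gs. gadget E f g"
    "distinct (concat gs)" "set (concat gs) \<subseteq> V"
    using disjoint_gadgets[where E = E and f = f and V = V and k = k and j = k] assms by blast
  obtain rs where rs: "set rs = V - set (concat gs)" "distinct rs"
    using fin finite_distinct_list[of "V - set (concat gs)"] by auto
  define bs where "bs = gs @ map (\<lambda>v. [v]) rs"
  have con: "concat bs = concat gs @ rs" by (simp add: bs_def)
  have cV: "distinct (concat bs)" "set (concat bs) = V" using gs rs unfolding con by auto
  have "length (concat gs) = 4 * k"
    using gs(1,2) by (induction gs arbitrary: k) (auto simp: gadget_def)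
  moreover have "length (concat bs) = card V" using cV distinct_card by metis
  ultimately have len: "length bs + 3 * k = card V" using gs(1) unfolding con by (simp add: bs_def)
  have ne: "\<forall>b\<in>set bs. b \<noteq> []" using gs(2) unfolding bs_def gadget_def by auto
  have brk: "sum_list (map (inner_gaps E) bs) = 0"
    using gs(2) unfolding bs_def by (auto simp: gadget_def inner_gaps_def)
  have "2 * k \<le> sum_list (map (gain f) gs)"
    using gs(1,2) by (induction gs arbitrary: k) (auto simp: gadget_def)
  then have gn: "2 * k \<le> sum_list (map (gain f) bs)" unfolding bs_def by simp
  have "\<exists>cs. same_blocks cs bs \<and> link_gaps E cs = 0"
  proof (rule hamilton_block_cycle)
    show "2 * card (set (concat bs)) \<le> card {w \<in> set (concat bs). E u w}
        + card {w \<in> set (concat bs). E v w} + length bs"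
      if "u \<in> set (concat bs)" "v \<in> set (concat bs)" "u \<noteq> v" "\<not> E u v" for u v
      using deg[of u v] that len unfolding cV(2) by linarith
  qed (use sym irr ne cV len V in auto)
  then obtain cs where cs: "same_blocks cs bs" "link_gaps E cs = 0" by blast
  have "sum_list (map (inner_gaps E) cs) = 0"
    using same_blocks_sum_list[OF cs(1), of "inner_gaps E"] inner_gaps_rev[of E] sym brk by metis
  moreover have "sum_list (map (gain f) cs) = sum_list (map (gain f) bs)"
    by (intro same_blocks_sum_list[OF cs(1)] gain_rev anti)
  ultimately obtain xs where "mset xs = mset (concat cs)" "cycle_sum (gap E) xs = 0"
    "int (sum_list (map (gain f) bs)) \<le> 2 * \<bar>cycle_sum f xs\<bar>"
    using exists_large_cycle_sum[of cs E f] same_blocks_nonempty[OF cs(1)] ne cs(2) by metis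
  moreover from this have "mset xs = mset (concat bs)" using same_blocks_mset_concat[OF cs(1)] by simp
  then have "distinct xs" "set xs = V"
    using cV by (metis mset_eq_imp_distinct_iff, metis mset_eq_setD)
  ultimately show ?thesis using gn by (intro exI[of _ xs]) simp
qed

lemma parcs_underlying_graph:
  "(x, y) \<in> parcs (underlying_graph D) \<longleftrightarrow> (x, y) \<in> parcs D \<or> (y, x) \<in> parcs D"
  by (simp add: underlying_graph_def parcs_mk_symmetric) (metis fst_conv snd_conv prod.collapse)

theorem theorem1p8:
  fixes D :: "'a pair_pre_digraph" and n :: nat and k :: int
  assumes "0 \<le> k"
    and "oriented_graph D"
    and "card (pverts D) = n"
    and "int n \<ge> 30 + 4 * (k - 1)"
    and "s_star D \<ge> 8 * k"
  shows "\<exists>C. hamilton_oriented_cycle D C \<and>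
           int (sigma_max D C) \<ge> \<lceil>(real n + real_of_int k) / 2\<rceil>"
proof -
  interpret oriented_graph D by fact
  obtain K where K: "k = int K" using assms(1) nonneg_int_cases by blast
  define V where "V = pverts D"
  define E where "E x y \<longleftrightarrow> (x, y) \<in> parcs (underlying_graph D)" for x y
  define f where "f x y = (of_bool ((x, y) \<in> parcs D) - of_bool ((y, x) \<in> parcs D) :: int)" for x y
  have E: "E x y \<longleftrightarrow> (x, y) \<in> parcs D \<or> (y, x) \<in> parcs D" for x y
    by (simp add: E_def parcs_underlying_graph)
  have fin: "finite V" using pair_finite_verts by (simp add: V_def)
  have deg_eq: "vertex_degree D u = card {w \<in> V. E u w}" for u
  proof -
    have "out_arcs (with_proj (underlying_graph D)) u = Pair u ` {w \<in> V. E u w}"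
      using in_arcsD1 in_arcsD2 by (auto simp: out_arcs_def E_def V_def parcs_underlying_graph)
    then show ?thesis
      unfolding vertex_degree_def out_degree_def by (simp add: card_image inj_on_def)
  qed
  have deg: "card V + 8 * K \<le> card {w \<in> V. E u w} + card {w \<in> V. E v w}"
    if "u \<in> V" "v \<in> V" "u \<noteq> v" "\<not> E u v" for u v
  proof -
    let ?M = "{int (vertex_degree D u) + int (vertex_degree D v) - int (card (pverts D)) | u v.
      (u, v) \<in> nonadjacent_pairs D}"
    have uv: "(u, v) \<in> nonadjacent_pairs D"
      using that unfolding nonadjacent_pairs_def E V_def by auto
    have "nonadjacent_pairs D \<subseteq> V \<times> V" by (auto simp: nonadjacent_pairs_def V_def)
    then have "finite (nonadjacent_pairs D)" by (rule finite_subset) (use fin in auto)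
    moreover have "?M = (\<lambda>(u, v). int (vertex_degree D u) + int (vertex_degree D v)
        - int (card (pverts D))) ` nonadjacent_pairs D" by auto
    ultimately have "finite ?M" by simp
    then have "Min ?M \<le> int (vertex_degree D u) + int (vertex_degree D v) - int (card (pverts D))"
      by (rule Min_le) (use uv in blast)
    moreover have "s_star D = Min ?M" using uv unfolding s_star_def by auto
    ultimately show ?thesis using assms(5) unfolding K deg_eq V_def by linarith
  qed
  have "\<exists>xs. distinct xs \<and> set xs = V \<and> cycle_sum (gap E) xs = 0 \<and> int K \<le> \<bar>cycle_sum f xs\<bar>"
  proof (rule hamilton_cycle_with_large_sum[OF _ _ _ _ fin _ deg])
    show "\<bar>f x y\<bar> = 1" if "E x y" for x y
      using that no_opposite_arcs unfolding E f_def by auto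
    show "4 * K + 2 \<le> card V" using K assms(3,4) unfolding V_def by simp
  qed (use pair_no_loops in \<open>fastforce simp: E f_def\<close>)+
  then obtain xs where xs: "distinct xs" "set xs = V" "cycle_sum (gap E) xs = 0" "k \<le> \<bar>cycle_sum f xs\<bar>"
    unfolding K by blast
  let ?nx = "\<lambda>i. xs ! (Suc i mod length xs)"
  have len: "length xs = n" using xs(1,2) assms(3) distinct_card unfolding V_def by metis
  have edges: "E (xs ! i) (?nx i)" if "i < length xs" for i
    using xs(3) that unfolding cycle_sum_nth by (auto simp: gap_def)
  have "hamilton_oriented_cycle D xs"
    using xs(1,2) edges len assms(1,4)
    unfolding hamilton_oriented_cycle_def oriented_cycle_def E_def V_def by auto
  moreover have "int (sigma_plus D xs) - int (sigma_minus D xs) = cycle_sum f xs"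
  proof -
    have "(\<Sum>i<length xs. of_bool (P i)) = int (card {i. i < length xs \<and> P i})" for P
    proof -
      have "{..<length xs} \<inter> {i. P i} = {i. i < length xs \<and> P i}" by auto
      then show ?thesis by simp
    qed
    then show ?thesis
      unfolding cycle_sum_nth sigma_plus_def sigma_minus_def f_def sum_subtractf by simp
  qed
  moreover have "sigma_plus D xs + sigma_minus D xs = n"
  proof -
    let ?P = "{i. i < length xs \<and> (xs ! i, ?nx i) \<in> parcs D}"
    let ?M = "{i. i < length xs \<and> (?nx i, xs ! i) \<in> parcs D}"
    have "?P \<inter> ?M = {}" using no_opposite_arcs by blast
    moreover have "?P \<union> ?M = {..<n}" using edges len unfolding E by auto
    ultimately show ?thesis unfolding sigma_plus_def sigma_minus_def
      by (metis (no_types, lifting) card_Un_disjoint card_lessThan finite_Un finite_lessThan)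
  qed
  ultimately have "int n + k \<le> 2 * int (sigma_max D xs)"
    using xs(4) unfolding sigma_max_def by linarith
  then have "real_of_int (int n + k) \<le> real_of_int (2 * int (sigma_max D xs))"
    by (simp only: of_int_le_iff)
  then have "(real n + real_of_int k) / 2 \<le> real_of_int (int (sigma_max D xs))" by simp
  then have "\<lceil>(real n + real_of_int k) / 2\<rceil> \<le> int (sigma_max D xs)" by (rule ceiling_le)
  with \<open>hamilton_oriented_cycle D xs\<close> show ?thesis by blast
qed

end
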